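(* Let $r$ and $d$ be two nonnegative integers and $P$ be a real polynomial of degree $d$. Let also $(T_n(X))_{n\ge 0}$ be the Carlitz-type $q$-polynomial sequence whose associated real sequence is $\left(\frac{P(k)}{[k+r]}\right)_{k\ge 0}$, and let $(t_n)_{n\ge 0}$ be the real sequence defined by $t_n:=T_n(0)$ for all $n\ge 0$. Then $(t_n)_n$ satisfies the symbolic formula $$q^r\left(qt+1\right)^n=t^n\qquad(\forall n>d),$$ that is, $$q^r\sum_{k=0}^{n}\binom{n}{k}q^k\,t_k=t_n\qquad(\forall n>d).$$
   Context: Let $q$ be a positive real parameter, $q\neq 1$, and put $[X]:=\frac{q^X-1}{q-1}$, where $X$ is an indeterminate or a number. A $q$-polynomial is a polynomial in $q^X$ (equivalently in $[X]$) with real coefficients. The Carlitz-type $q$-polynomial sequence associated to a real sequence $(a_k)_{k\ge 0}$ is the sequence $(T_n(X))_{n\ge 0}$ defined by $$T_n(X)=(q-1)^{-n}\sum_{k=0}^{n}(-1)^{n-k}\binom{n}{k}a_k\,q^{kX}.$$ In symbolic formulas one expands by the binomial theorem and then replaces each power $t^k$ by $t_k$. The paper's convention is that $\frac{k}{[k]}=1$ for $k=0$.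
   Formalization: For r = 0 it is additionally assumed that P(0) = 0, since otherwise the term P(0)/[0] is undefined and the formula fails for every choice of its value; P(k)/[k] at k = 0 is then read, via k/[k] = 1, as the coefficient of X in P. *)

theory Defs
  imports Complex_Main "HOL-Computational_Algebra.Polynomial"
begin

definition qbracket :: "real \<Rightarrow> real \<Rightarrow> real" where
  "qbracket q x = (q powr x - 1) / (q - 1)"

text \<open>A \<open>q\<close>-polynomial is represented by the function of the real variable \<open>x\<close> it defines.\<close>

definition carlitz_T :: "real \<Rightarrow> (nat \<Rightarrow> real) \<Rightarrow> nat \<Rightarrow> real \<Rightarrow> real" where
  "carlitz_T q a n x =
     inverse ((q - 1) ^ n) *
     (\<Sum>k\<le>n. (-1) ^ (n - k) * real (n choose k) * a k * q powr (real k * x))"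

definition qratio :: "real \<Rightarrow> nat \<Rightarrow> real" where
  "qratio q k = (if k = 0 then 1 else real k / qbracket q (real k))"

text \<open>The sequence \<open>P(k) / [k + r]\<close>. The denominator vanishes only for \<open>k = r = 0\<close>. There the
  quotient has a meaning only when \<open>P(0) = 0\<close>, say \<open>P = X Q\<close>; it is then read as
  \<open>Q(k) (k / [k])\<close> at \<open>k = 0\<close>, with the convention \<open>k / [k] = 1\<close>, and \<open>Q(0)\<close> is the coefficient
  of \<open>X\<close> in \<open>P\<close>. The lemma below confirms this reading for all \<open>k\<close>.\<close>

definition qquot :: "real \<Rightarrow> nat \<Rightarrow> real poly \<Rightarrow> nat \<Rightarrow> real" where
  "qquot q r P k =
     (if k + r = 0 then coeff P 1 * qratio q 0
      else poly P (real k) / qbracket q (real (k + r)))"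

lemma qquot_0: "qquot q 0 ([:0, 1:] * Q) k = poly Q (real k) * qratio q k"
  by (simp add: qquot_def qratio_def poly_0_coeff_0)

text \<open>Symbolic evaluation: each power \<open>t ^ k\<close> of the indeterminate is replaced by \<open>t k\<close>.\<close>

definition umbral :: "(nat \<Rightarrow> real) \<Rightarrow> real poly \<Rightarrow> real" where
  "umbral t p = (\<Sum>k\<le>degree p. coeff p k * t k)"

end

theory Submission
  imports Defs
begin

text \<open>
  The umbral functional of \<open>t\<close> is the umbral functional of \<open>a\<close> composed with the substitution
  \<open>x = (y - 1) / (q - 1)\<close>. This substitution turns \<open>q x + 1\<close> into \<open>(q y - 1) / (q - 1)\<close>, so up to
  the factor \<open>(q - 1) ^ n\<close> the difference of both sides is the \<open>n\<close>-th finite difference at \<open>0\<close> of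
  \<open>(q ^ (k + r) - 1) * a k = (q - 1) * P k\<close>, which vanishes for \<open>n > degree P\<close>.
\<close>

text \<open>Coefficients beyond the degree vanish, so polynomials of different degrees can be summed
  over one common range.\<close>

lemma umbral_eq_sum:
  assumes "degree p \<le> n"
  shows "umbral t p = (\<Sum>k\<le>n. coeff p k * t k)"
  unfolding umbral_def using assms
  by (intro sum.mono_neutral_left) (auto simp: coeff_eq_0)

lemma umbral_0 [simp]: "umbral t 0 = 0"
  by (simp add: umbral_def)

lemma umbral_add: "umbral t (p + p') = umbral t p + umbral t p'"
proof -
  have "degree (p + p') \<le> max (degree p) (degree p')"
    by (rule degree_add_le) auto
  then show ?thesis
    by (simp add: umbral_eq_sum[where n = "max (degree p) (degree p')"]
        sum.distrib algebra_simps)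
qed

lemma umbral_smult: "umbral t (smult c p) = c * umbral t p"
  using umbral_eq_sum[OF degree_smult_le, of t c p]
  by (simp add: umbral_def sum_distrib_left mult.assoc)

lemma umbral_monom: "umbral t (monom c n) = c * t n"
proof -
  have "umbral t (monom c n) = (\<Sum>k\<le>n. coeff (monom c n) k * t k)"
    by (rule umbral_eq_sum) (rule degree_monom_le)
  then show ?thesis
    by (simp add: if_distrib[of "\<lambda>x. x * _"] sum.delta cong: if_cong)
qed

lemma umbral_pCons: "umbral t (pCons c p) = c * t 0 + umbral (\<lambda>k. t (Suc k)) p"
proof -
  have "umbral t (pCons c p) = (\<Sum>k\<le>Suc (degree p). coeff (pCons c p) k * t k)"
    by (rule umbral_eq_sum) (rule degree_pCons_le)
  then show ?thesis
    by (simp add: umbral_def sum.atMost_Suc_shift del: sum.atMost_Suc)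
qed

lemma umbral_linear_power:
  "umbral t ([:c, e:] ^ n) = (\<Sum>k\<le>n. real (n choose k) * c ^ (n - k) * e ^ k * t k)"
proof -
  \<comment> \<open>Only a bound holds in general: for \<open>e = 0\<close> the power is
    constant.\<close>
  have "degree ([:c, e:] ^ n) \<le> n"
    using degree_power_le[of "[:c, e:]" n] by (auto split: if_splits)
  then show ?thesis
    by (simp add: umbral_eq_sum[where n = n] coeff_linear_poly_power mult_ac)
qed

text \<open>Both sides are linear in \<open>p\<close> and agree on monomials by assumption, hence on
  all polynomials.\<close>

lemma umbral_pcompose:
  assumes "\<And>n. t n = umbral a (u ^ n)"
  shows "umbral t p = umbral a (p \<circ>\<^sub>p u)"
proof -
  \<comment> \<open>Peeling off a coefficient shifts the sequence by one and leaves one more factor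
    \<open>u\<close>; the offset \<open>m\<close> keeps the induction closed under this.\<close>
  have "umbral (\<lambda>k. t (m + k)) p = umbral a (u ^ m * (p \<circ>\<^sub>p u))" for m
  proof (induction p arbitrary: m)
    case 0
    then show ?case by simp
  next
    case (pCons c p)
    show ?case
      using pCons.IH[of "Suc m"] assms[of m]
      by (simp add: umbral_pCons pcompose_pCons algebra_simps umbral_add umbral_smult)
  qed
  from this[of 0] show ?thesis by simp
qed

text \<open>Multiplication by the indeterminate acts as the shift on sequences, so multiplication by
  the indeterminate minus one acts as the forward difference.\<close>

lemma umbral_mult_difference:
  "umbral t ([:-1, 1:] * p) = umbral (\<lambda>k. t (Suc k) - t k) p"
proof -
  have "[:-1, 1:] * p = smult (-1) p + pCons 0 p"
    by simp
  then have "umbral t ([:-1, 1:] * p) = umbral (\<lambda>k. t (Suc k)) p - umbral t p"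
    by (simp only: umbral_add umbral_smult umbral_pCons)
  then show ?thesis
    by (simp add: umbral_def sum_subtractf right_diff_distrib)
qed

text \<open>Each forward difference lowers the degree until the zero polynomial is reached. The
  disjunct \<open>P = 0\<close> covers that end, where no degree is below
  \<open>n = 0\<close>.\<close>

lemma umbral_finite_difference:
  assumes "degree P < n \<or> P = 0"
  shows "umbral (\<lambda>k. poly P (real k)) ([:-1, 1:] ^ n) = 0"
  using assms
proof (induction n arbitrary: P)
  case 0
  then show ?case by (simp add: umbral_def)
next
  case (Suc n)
  define D where "D = P \<circ>\<^sub>p [:1, 1:] - P"
  have "D = 0 \<or> degree D < degree P"
  proof (rule eq_zero_or_degree_less)
    show "degree D \<le> degree P"
      unfolding D_def by (rule degree_diff_le) (simp_all add: degree_pcompose)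
    \<comment> \<open>Translation by 1 preserves the leading coefficient, so it cancels in
      \<open>D\<close>.\<close>
    have "coeff (P \<circ>\<^sub>p [:1, 1:]) (degree P) = coeff P (degree P)"
      using lead_coeff_comp[of "[:1, 1:]" P] by (simp add: degree_pcompose)
    then show "coeff D (degree P) = 0"
      by (simp add: D_def)
  qed
  then have "degree D < n \<or> D = 0"
    using Suc.prems by (auto simp: D_def)
  then have IH: "umbral (\<lambda>k. poly D (real k)) ([:-1, 1:] ^ n) = 0"
    by (rule Suc.IH)
  have "poly D (real k) = poly P (real (Suc k)) - poly P (real k)" for k
    by (simp add: D_def poly_pcompose)
  with IH show ?case
    by (simp only: power_Suc umbral_mult_difference)
qed

lemma qquot_cancel:
  assumes "q > 0" "q \<noteq> 1" "r = 0 \<longrightarrow> poly P 0 = 0"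
  shows "(q ^ (k + r) - 1) * qquot q r P k = (q - 1) * poly P (real k)"
proof (cases "k + r = 0")
  case True
  \<comment> \<open>Both sides are zero: \<open>q ^ 0 - 1\<close> on the left,
    \<open>poly P 0\<close> on the right.\<close>
  then show ?thesis using assms by simp
next
  case False
  have "q ^ (k + r) \<noteq> 1"
    using assms(1,2) False power_eq_1_iff[of q "k + r"] by auto
  moreover have "qbracket q (real (k + r)) = (q ^ (k + r) - 1) / (q - 1)"
    using assms(1) by (simp only: qbracket_def powr_realpow)
  ultimately show ?thesis
    using False assms(2,3) by (simp add: qquot_def)
qed

text \<open>At \<open>x = 0\<close> every power of \<open>q\<close> in the sum is 1, leaving a
  binomial expansion.\<close>

lemma carlitz_T_0:
  assumes "q > 0"
  shows "carlitz_T q a n 0 = umbral a ([:- 1 / (q - 1), 1 / (q - 1):] ^ n)"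
proof -
  have "[:- 1 / (q - 1), 1 / (q - 1):] = smult (inverse (q - 1)) [:- 1, 1:]"
    by (simp add: divide_inverse)
  then have "umbral a ([:- 1 / (q - 1), 1 / (q - 1):] ^ n)
      = inverse (q - 1) ^ n * umbral a ([:- 1, 1:] ^ n)"
    by (simp only: smult_power umbral_smult)
  then show ?thesis
    using assms by (simp add: carlitz_T_def umbral_linear_power power_inverse mult_ac)
qed

theorem theorem2p9:
  fixes q :: real and r d :: nat and P :: "real poly"
    and T :: "nat \<Rightarrow> real \<Rightarrow> real" and t :: "nat \<Rightarrow> real"
  assumes "q > 0" and "q \<noteq> 1"
    and "degree P = d"
    and "r = 0 \<longrightarrow> poly P 0 = 0"
    and "\<And>n. T n = carlitz_T q (qquot q r P) n"
    and "\<And>n. t n = T n 0"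
  shows "\<forall>n>d. umbral t (smult (q ^ r) ([:1, q:] ^ n)) = umbral t (monom 1 n)
             \<and> q ^ r * (\<Sum>k\<le>n. real (n choose k) * q ^ k * t k) = t n"
proof (intro allI impI)
  fix n assume "n > d"
  define a where "a = qquot q r P"
  define s where "s = inverse (q - 1)"
  define u where "u = smult s [:- 1, 1:]"
  have t: "t m = umbral a (u ^ m)" for m
    using assms(1,5,6) carlitz_T_0[of q a m]
    by (simp add: a_def u_def s_def divide_inverse)
  \<comment> \<open>Since \<open>s * (q - 1) = 1\<close>, the constant term is
    \<open>1 - s * q = - s\<close>.\<close>
  have "[:1, q:] \<circ>\<^sub>p u = smult s [:- 1, q:]"
    using assms(2) by (simp add: u_def s_def pcompose_pCons field_simps)
  moreover have "p ^ n \<circ>\<^sub>p u = (p \<circ>\<^sub>p u) ^ n" for p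
    by (induction n) (simp_all add: pcompose_mult pcompose_1)
  ultimately have "umbral t ([:1, q:] ^ n) = s ^ n * umbral a ([:- 1, q:] ^ n)"
    by (simp add: umbral_pcompose[OF t] smult_power umbral_smult del: smult_pCons)
  moreover have "t n = s ^ n * umbral a ([:- 1, 1:] ^ n)"
    by (simp add: t u_def smult_power umbral_smult del: smult_pCons)
  moreover have "q ^ r * umbral a ([:- 1, q:] ^ n) - umbral a ([:- 1, 1:] ^ n) = 0"
  proof -
    \<comment> \<open>The two expansions differ only by the factor \<open>q ^ r * q ^ k\<close>
      against 1 in each term.\<close>
    have "q ^ r * umbral a ([:- 1, q:] ^ n) - umbral a ([:- 1, 1:] ^ n)
        = (\<Sum>k\<le>n. real (n choose k) * (- 1) ^ (n - k) * ((q ^ (k + r) - 1) * a k))"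
      by (simp add: umbral_linear_power sum_distrib_left power_add algebra_simps
          flip: sum_subtractf)
    also have "\<dots> = (\<Sum>k\<le>n. real (n choose k) * (- 1) ^ (n - k) * ((q - 1) * poly P (real k)))"
      by (simp only: a_def qquot_cancel[OF assms(1,2,4)])
    also have "\<dots> = (q - 1) * umbral (\<lambda>k. poly P (real k)) ([:- 1, 1:] ^ n)"
      by (simp add: umbral_linear_power sum_distrib_left mult_ac)
    also have "\<dots> = 0"
      using \<open>n > d\<close> assms(3) by (simp add: umbral_finite_difference)
    finally show ?thesis .
  qed
  ultimately have "q ^ r * umbral t ([:1, q:] ^ n) = t n"
    by (simp add: algebra_simps)
  then show "umbral t (smult (q ^ r) ([:1, q:] ^ n)) = umbral t (monom 1 n)
      \<and> q ^ r * (\<Sum>k\<le>n. real (n choose k) * q ^ k * t k) = t n"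
    by (simp add: umbral_smult umbral_monom umbral_linear_power)
qed

end
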